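(* Let $s'(n)$ denote the maximum number of stable models of a normal logic program of size at most $n$. Then for every integer $n\ge1$, $s'(n)=\Theta(2^{n/4})$.
   Context: A (normal, propositional) logic program is a finite set of clauses $a\leftarrow b_1,\ldots,b_m,\mathbf{not}(c_1),\ldots,\mathbf{not}(c_k)$ ($m,k\ge0$) with atoms $a,b_i,c_j$. For a set of atoms $M$, the Gelfond–Lifschitz reduct $P^M$ is obtained from $P$ by deleting every clause whose body contains $\mathbf{not}(c)$ with $c\in M$ and deleting all negative literals from the remaining clauses; $M$ is a stable model of $P$ if $M$ is the least model of the Horn program $P^M$. The size of a program is the total number of atom occurrences in it (in heads and bodies, counting negated occurrences). *)

theory Defs
  imports Complex_Main "HOL-Library.Infinite_Typeclass"
begin

(* Clause a [b1,...,bm] [c1,...,ck] stands for a <- b1,...,bm, not(c1),...,not(ck).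
   Bodies are lists because the size of a program counts atom occurrences. *)
datatype 'a clause = Clause (head: 'a) (pos: "'a list") (neg: "'a list")

type_synonym 'a program = "'a clause set"

definition satisfies :: "'a set \<Rightarrow> 'a clause \<Rightarrow> bool" where
  "satisfies M r \<longleftrightarrow> (set (pos r) \<subseteq> M \<and> set (neg r) \<inter> M = {} \<longrightarrow> head r \<in> M)"

definition is_model :: "'a program \<Rightarrow> 'a set \<Rightarrow> bool" where
  "is_model P M \<longleftrightarrow> (\<forall>r\<in>P. satisfies M r)"

definition is_least_model :: "'a program \<Rightarrow> 'a set \<Rightarrow> bool" where
  "is_least_model P M \<longleftrightarrow> is_model P M \<and> (\<forall>N. is_model P N \<longrightarrow> M \<subseteq> N)"

definition reduct :: "'a program \<Rightarrow> 'a set \<Rightarrow> 'a program" where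
  "reduct P M = {Clause (head r) (pos r) [] | r. r \<in> P \<and> set (neg r) \<inter> M = {}}"

definition stable_model :: "'a program \<Rightarrow> 'a set \<Rightarrow> bool" where
  "stable_model P M \<longleftrightarrow> is_least_model (reduct P M) M"

definition clause_size :: "'a clause \<Rightarrow> nat" where
  "clause_size r = 1 + length (pos r) + length (neg r)"

definition program_size :: "'a program \<Rightarrow> nat" where
  "program_size P = (\<Sum>r\<in>P. clause_size r)"

definition stable_model_counts :: "'a itself \<Rightarrow> nat \<Rightarrow> nat set" where
  "stable_model_counts _ n =
     {card {M. stable_model P M} | P :: 'a program. finite P \<and> program_size P \<le> n}"

(* The atoms are the elements of the type 'a, assumed infinite so that the supply of atoms
   does not restrict programs. *)
definition s' :: "'a::infinite itself \<Rightarrow> nat \<Rightarrow> nat" where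
  "s' T n = Max (stable_model_counts T n)"

(* The following facts show that the cardinalities and the maximum above are taken over
   finite (and, for the maximum, nonempty) sets. *)

lemma stable_model_subset_heads:
  assumes "stable_model P M"
  shows "M \<subseteq> head ` P"
proof -
  have "is_model (reduct P M) (head ` P)"
    by (auto simp: is_model_def satisfies_def reduct_def)
  then show ?thesis
    using assms by (simp add: stable_model_def is_least_model_def)
qed

lemma stable_models_subset_Pow: "{M. stable_model P M} \<subseteq> Pow (head ` P)"
  using stable_model_subset_heads by blast

lemma finite_stable_models: "finite P \<Longrightarrow> finite {M. stable_model P M}"
  by (rule finite_subset[OF stable_models_subset_Pow]) simp

lemma finite_stable_model_counts: "finite (stable_model_counts T n)"
proof (rule finite_subset)
  show "stable_model_counts T n \<subseteq> {..2 ^ n}"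
  proof
    fix k assume "k \<in> stable_model_counts T n"
    then obtain P :: "'a program" where k: "k = card {M. stable_model P M}"
      and fin: "finite P" and size: "program_size P \<le> n"
      by (auto simp: stable_model_counts_def)
    have "k \<le> card (Pow (head ` P))"
      unfolding k using fin by (intro card_mono stable_models_subset_Pow) simp
    also have "\<dots> = 2 ^ card (head ` P)"
      using fin by (simp add: card_Pow)
    also have "\<dots> \<le> 2 ^ n"
    proof (rule power_increasing)
      have "card (head ` P) \<le> card P"
        using fin by (rule card_image_le)
      also have "\<dots> = (\<Sum>r\<in>P. 1)"
        by simp
      also have "\<dots> \<le> program_size P"
        unfolding program_size_def clause_size_def by (rule sum_mono) simp
      finally show "card (head ` P) \<le> n"
        using size by simp
    qed simp
    finally show "k \<in> {..2 ^ n}"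
      by simp
  qed
qed simp

lemma stable_model_counts_nonempty: "stable_model_counts T n \<noteq> {}"
proof -
  have "finite ({} :: 'a program) \<and> program_size ({} :: 'a program) \<le> n"
    by (simp add: program_size_def)
  then show ?thesis
    unfolding stable_model_counts_def by blast
qed

end

theory Submission imports Defs begin

text \<open>
  Lower bound: each pair of clauses \<open>a \<leftarrow> not b\<close>, \<open>b \<leftarrow> not a\<close> costs four occurrences and doubles
  the number of stable models.

  Upper bound: a program of size \<open>n\<close> has at most \<open>2 powr (n / 4)\<close> stable models, by branching on the
  truth value of an atom \<open>q\<close>. Fixing that value deletes all occurrences of \<open>q\<close>, all clauses with
  head \<open>q\<close>, and all clauses whose body is falsified. An atom with the same value in all stable
  models is eliminated without branching; otherwise every occurring atom \<open>q\<close> is the head of a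
  clause \<open>r\<close> with nonempty body not mentioning \<open>q\<close>. Choose \<open>q\<close> occurring negated, in \<open>r'\<close> say. If \<open>q\<close>
  is true, then \<open>r\<close> and \<open>r'\<close> disappear, at least four occurrences. If \<open>q\<close> is false, then \<open>r\<close> and the
  occurrence of \<open>q\<close> in \<open>r'\<close> disappear. This is less than four only if the body of \<open>r\<close> is a single
  literal; but that literal is false, which fixes the value of a second atom and removes its
  occurrences as well. If nothing occurs negated, there is at most one stable model.
\<close>

subsection \<open>Fixing the truth value of an atom\<close>

definition strip :: "'a \<Rightarrow> 'a clause \<Rightarrow> 'a clause" where
  "strip q r = Clause (head r) (removeAll q (pos r)) (removeAll q (neg r))"

text \<open>Clauses with head \<open>q\<close> go for either value, which is taken as given and not
  rederived. In the kept clauses every literal on \<open>q\<close> is true, so \<open>strip\<close>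
  may erase it.\<close>

definition assign :: "'a \<Rightarrow> bool \<Rightarrow> 'a program \<Rightarrow> 'a program" where
  "assign q b P = strip q ` {r \<in> P. head r \<noteq> q \<and> q \<notin> set (if b then neg r else pos r)}"

definition loss :: "'a \<Rightarrow> bool \<Rightarrow> 'a clause \<Rightarrow> nat" where
  "loss q b r = (if head r = q \<or> q \<in> set (if b then neg r else pos r) then clause_size r
     else clause_size r - clause_size (strip q r))"

definition clause_atoms :: "'a clause \<Rightarrow> 'a set" where
  "clause_atoms r = insert (head r) (set (pos r) \<union> set (neg r))"

text \<open>Keeps later arguments on the clauses of \<open>P\<close> itself: negation is read in
  \<open>M\<close>, positive bodies and heads in \<open>N\<close>.\<close>

lemma is_model_reduct:
  "is_model (reduct P M) N \<longleftrightarrow>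
    (\<forall>r\<in>P. set (neg r) \<inter> M = {} \<longrightarrow> set (pos r) \<subseteq> N \<longrightarrow> head r \<in> N)"
proof -
  have "reduct P M = (\<lambda>r. Clause (head r) (pos r) []) ` {r \<in> P. set (neg r) \<inter> M = {}}"
    by (auto simp: reduct_def)
  then show ?thesis
    by (auto simp: is_model_def satisfies_def)
qed

lemma stable_model_iff:
  "stable_model P M \<longleftrightarrow>
    is_model (reduct P M) M \<and> (\<forall>N. is_model (reduct P M) N \<longrightarrow> M \<subseteq> N)"
  by (simp add: stable_model_def is_least_model_def)

text \<open>A body holds in \<open>M\<close> iff its stripped form holds in \<open>M - {q}\<close>,
  because the erased literals are true in \<open>M\<close>. The converse fails, as support for
  \<open>q\<close> is forgotten, but an upper bound needs one direction only.\<close>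

lemma stable_model_assign:
  assumes "stable_model P M" "(q \<in> M) = b"
  shows "stable_model (assign q b P) (M - {q})"
proof -
  have M: "is_model (reduct P M) M" and least: "\<And>N. is_model (reduct P M) N \<Longrightarrow> M \<subseteq> N"
    using assms(1) by (auto simp: stable_model_iff)
  have "is_model (reduct (assign q b P) (M - {q})) (M - {q})"
    unfolding is_model_reduct
  proof (intro ballI impI)
    fix s assume "s \<in> assign q b P" and s: "set (neg s) \<inter> (M - {q}) = {}" "set (pos s) \<subseteq> M - {q}"
    then obtain r where r: "r \<in> P" "head r \<noteq> q" "q \<notin> set (if b then neg r else pos r)"
      and sr: "s = strip q r"
      by (auto simp: assign_def)
    have "set (neg r) \<inter> M = {}" "set (pos r) \<subseteq> M"
      using s r(3) assms(2) by (auto simp: sr strip_def split: if_splits)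
    then have "head r \<in> M"
      using M r(1) by (auto simp: is_model_reduct)
    then show "head s \<in> M - {q}"
      using r(2) by (simp add: sr strip_def)
  qed
  moreover have "M - {q} \<subseteq> N" if N: "is_model (reduct (assign q b P) (M - {q})) N" for N
  proof -
    \<comment> \<open>Adding \<open>q\<close> makes up for the dropped clauses with head
      \<open>q\<close>; intersecting with \<open>M\<close> keeps \<open>q\<close> out when it is
      false.\<close>
    have "is_model (reduct P M) (M \<inter> insert q N)"
      unfolding is_model_reduct
    proof (intro ballI impI)
      fix r assume r: "r \<in> P" "set (neg r) \<inter> M = {}" "set (pos r) \<subseteq> M \<inter> insert q N"
      then have "head r \<in> M"
        using M by (auto simp: is_model_reduct)
      moreover have "head r \<in> N" if "head r \<noteq> q"
      proof -
        have "strip q r \<in> assign q b P"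
          using r that assms(2) by (auto simp: assign_def)
        then have "head (strip q r) \<in> N"
          using N r(2,3) unfolding is_model_reduct by (fastforce simp: strip_def)
        then show ?thesis
          by (simp add: strip_def)
      qed
      ultimately show "head r \<in> M \<inter> insert q N"
        by blast
    qed
    from least[OF this] show ?thesis
      by blast
  qed
  ultimately show ?thesis
    by (simp add: stable_model_iff)
qed

lemma finite_assign: "finite P \<Longrightarrow> finite (assign q b P)"
  by (simp add: assign_def)

text \<open>Deleting atoms whose value is constant on \<open>\<M>\<close> is injective.
  \<open>\<M>\<close> may be one branch of a case split; the second claim serves a branch that
  forces a further atom.\<close>

lemma card_stable_models_assign:
  assumes "finite P" "\<And>M. M \<in> \<M> \<Longrightarrow> stable_model P M \<and> (q \<in> M) = b"
  shows "card \<M> \<le> card {M. stable_model (assign q b P) M}"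
    and "(\<And>M. M \<in> \<M> \<Longrightarrow> (c \<in> M) = d) \<Longrightarrow> c \<noteq> q \<Longrightarrow>
      card \<M> \<le> card {M. stable_model (assign c d (assign q b P)) M}"
proof -
  have inj: "inj_on (\<lambda>M. M - {q}) \<M>"
    using assms(2) by (intro inj_onI) blast
  show "card \<M> \<le> card {M. stable_model (assign q b P) M}"
    by (intro card_inj_on_le[OF inj] finite_stable_models finite_assign assms(1))
      (use assms(2) in \<open>auto intro!: stable_model_assign\<close>)
  assume c: "\<And>M. M \<in> \<M> \<Longrightarrow> (c \<in> M) = d" "c \<noteq> q"
  have "inj_on (\<lambda>M. M - {q} - {c}) \<M>"
  proof (rule inj_onI)
    fix M N assume MN: "M \<in> \<M>" "N \<in> \<M>" and eq: "M - {q} - {c} = N - {q} - {c}"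
    have "(x \<in> M) = (x \<in> N)" for x
    proof (cases "x = q \<or> x = c")
      case True
      then show ?thesis
        using MN assms(2) c(1) by metis
    next
      case False
      then show ?thesis
        using eq by blast
    qed
    then show "M = N"
      by blast
  qed
  moreover have "stable_model (assign c d (assign q b P)) (M - {q} - {c})" if "M \<in> \<M>" for M
    using that assms(2) c by (intro stable_model_assign) auto
  then have "(\<lambda>M. M - {q} - {c}) ` \<M> \<subseteq> {M. stable_model (assign c d (assign q b P)) M}"
    by blast
  moreover have "finite {M. stable_model (assign c d (assign q b P)) M}"
    by (intro finite_stable_models finite_assign assms(1))
  ultimately show "card \<M> \<le> card {M. stable_model (assign c d (assign q b P)) M}"
    by (rule card_inj_on_le)
qed

section \<open>Size after an assignment\<close>

lemma clause_size_strip_le: "clause_size (strip q r) \<le> clause_size r"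
  unfolding clause_size_def strip_def clause.sel
  by (intro add_mono length_removeAll_less_eq order_refl)

lemma loss_pos:
  assumes "q \<in> clause_atoms r"
  shows "0 < loss q b r"
proof -
  have "clause_size (strip q r) < clause_size r" if "q \<in> set (pos r) \<union> set (neg r)"
    using that
  proof
    assume "q \<in> set (pos r)"
    from add_less_le_mono[OF length_removeAll_less[OF this] length_removeAll_less_eq]
    show ?thesis
      by (simp add: clause_size_def strip_def)
  next
    assume "q \<in> set (neg r)"
    from add_le_less_mono[OF length_removeAll_less_eq length_removeAll_less[OF this]]
    show ?thesis
      by (simp add: clause_size_def strip_def)
  qed
  then show ?thesis
    using assms by (auto simp: loss_def clause_atoms_def clause_size_def)
qed

lemma program_size_assign:
  assumes "finite P" "A \<subseteq> P"
  shows "program_size (assign q b P) + (\<Sum>r\<in>A. loss q b r) \<le> program_size P"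
proof -
  define Q where "Q = {r \<in> P. head r \<noteq> q \<and> q \<notin> set (if b then neg r else pos r)}"
  have Q: "Q \<subseteq> P" "finite Q"
    using assms(1) by (auto simp: Q_def)
  \<comment> \<open>Only an inequality: stripping may merge distinct clauses.\<close>
  have "program_size (assign q b P) \<le> (\<Sum>r\<in>Q. clause_size (strip q r))"
    unfolding program_size_def assign_def Q_def[symmetric]
    using sum_image_le[OF Q(2), of clause_size "strip q"] by (simp add: o_def)
  also have "\<dots> = (\<Sum>r\<in>P. if r \<in> Q then clause_size (strip q r) else 0)"
    using assms(1) Q(1) by (simp add: sum.inter_restrict[symmetric] Int_absorb1)
  also have "\<dots> + (\<Sum>r\<in>A. loss q b r) \<le> \<dots> + (\<Sum>r\<in>P. loss q b r)"
    using assms by (intro add_left_mono sum_mono2) auto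
  also have "\<dots> = (\<Sum>r\<in>P. (if r \<in> Q then clause_size (strip q r) else 0) + loss q b r)"
    by (simp add: sum.distrib)
  also have "\<dots> = program_size P"
    unfolding program_size_def
    by (rule sum.cong) (auto simp: Q_def loss_def clause_size_strip_le)
  finally show ?thesis
    by simp
qed

lemma program_size_assign_less:
  assumes "finite P" "r \<in> P" "q \<in> clause_atoms r"
  shows "program_size (assign q b P) < program_size P"
  using program_size_assign[of P "{r}" q b] loss_pos[OF assms(3), of b] assms(1,2) by simp

lemma program_size_assign_two:
  assumes "finite P" "r \<in> P" "s \<in> P" "r \<noteq> s"
  shows "program_size (assign q b P) + (loss q b r + loss q b s) \<le> program_size P"
  using program_size_assign[of P "{r, s}" q b] assms by simp

subsection \<open>The upper bound\<close>

lemma stable_model_fact: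
  assumes "stable_model P M" "r \<in> P" "pos r = []" "neg r = []"
  shows "head r \<in> M"
  using assms unfolding stable_model_iff is_model_reduct by simp

text \<open>Otherwise \<open>M - {q}\<close> is a smaller model of the reduct: a clause for
  \<open>q\<close> with \<open>q\<close> negated is deleted from it, and one with \<open>q\<close>
  positive does not fire.\<close>

lemma stable_model_supported:
  assumes "stable_model P M" "q \<in> M"
  shows "\<exists>r\<in>P. head r = q \<and> q \<notin> set (pos r) \<and> q \<notin> set (neg r)"
proof (rule ccontr)
  assume *: "\<not> ?thesis"
  have "is_model (reduct P M) (M - {q})"
    unfolding is_model_reduct
  proof (intro ballI impI)
    fix r assume r: "r \<in> P" "set (neg r) \<inter> M = {}" "set (pos r) \<subseteq> M - {q}"
    then have "head r \<in> M"
      using assms(1) by (auto simp: stable_model_iff is_model_reduct)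
    moreover have "head r \<noteq> q"
      using * r assms(2) by auto
    ultimately show "head r \<in> M - {q}"
      by simp
  qed
  then show False
    using assms by (auto simp: stable_model_iff)
qed

text \<open>Without negation the reduct is the same for every \<open>M\<close>, and a least model is
  unique.\<close>

lemma card_stable_models_Horn_le:
  assumes "\<And>r. r \<in> P \<Longrightarrow> neg r = []"
  shows "card {M. stable_model P M} \<le> 1"
proof -
  have "is_model (reduct P M) L = is_model (reduct P N) L" for L M N
    using assms by (simp add: is_model_reduct)
  then have "M \<subseteq> N" if "stable_model P M" "stable_model P N" for M N
    using that unfolding stable_model_iff by metis
  then have "M = N" if "stable_model P M" "stable_model P N" for M N
    using that by (simp add: subset_antisym)
  \<comment> \<open>An infinite set has \<open>card\<close> 0.\<close>
  then show ?thesis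
    by (cases "finite {M. stable_model P M}") (auto simp: card_le_Suc0_iff_eq)
qed

text \<open>\<open>r\<close> and \<open>s\<close> differ, since only \<open>s\<close> negates
  \<open>q\<close>; both are deleted whole, with at least two occurrences each.\<close>

lemma program_size_assign_true:
  assumes "finite P" "r \<in> P" "head r = q" "q \<notin> set (neg r)" "pos r \<noteq> [] \<or> neg r \<noteq> []"
    and "s \<in> P" "q \<in> set (neg s)"
  shows "program_size (assign q True P) + 4 \<le> program_size P"
proof -
  have "2 \<le> loss q True r"
    using assms(3,5) by (cases "pos r"; cases "neg r") (auto simp: loss_def clause_size_def)
  moreover have "2 \<le> loss q True s"
    using assms(7) by (cases "neg s") (auto simp: loss_def clause_size_def)
  ultimately show ?thesis
    using program_size_assign_two[of P r s q True] assms by fastforce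
qed

text \<open>The second case keeps every clause not headed by \<open>q\<close>, so that an atom
  forced by \<open>r\<close> can still be found in the remaining program.\<close>

lemma program_size_assign_false:
  assumes "finite P" "r \<in> P" "head r = q" "q \<notin> set (neg r)" "pos r \<noteq> [] \<or> neg r \<noteq> []"
    and "s \<in> P" "q \<in> set (neg s)"
  obtains "program_size (assign q False P) + 4 \<le> program_size P"
    | "clause_size r = 2" "program_size (assign q False P) + 3 \<le> program_size P"
      "\<And>t. t \<in> P \<Longrightarrow> head t \<noteq> q \<Longrightarrow> strip q t \<in> assign q False P"
proof (cases "program_size (assign q False P) + 4 \<le> program_size P")
  case False
  have r: "loss q False r = clause_size r" "2 \<le> clause_size r"
    using assms(3,5) by (cases "pos r"; cases "neg r"; auto simp: loss_def clause_size_def)+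
  have s: "0 < loss q False s"
    using assms(7) by (intro loss_pos) (simp add: clause_atoms_def)
  have rs: "program_size (assign q False P) + (loss q False r + loss q False s) \<le> program_size P"
    using assms by (intro program_size_assign_two) auto
  \<comment> \<open>Deleting \<open>t\<close> as well would save two occurrences beyond those of
    \<open>r\<close>, four in all.\<close>
  have "strip q t \<in> assign q False P" if t: "t \<in> P" "head t \<noteq> q" for t
  proof (rule ccontr)
    assume "strip q t \<notin> assign q False P"
    then have "q \<in> set (pos t)"
      using t by (auto simp: assign_def)
    then have "2 \<le> loss q False t"
      by (cases "pos t") (auto simp: loss_def clause_size_def)
    moreover have "program_size (assign q False P) + (loss q False r + loss q False t) \<le> program_size P"
      using assms t by (intro program_size_assign_two) auto
    ultimately show False
      using False r by linarith
  qed
  moreover have "clause_size r = 2" "program_size (assign q False P) + 3 \<le> program_size P"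
    using False r s rs by linarith+
  ultimately show ?thesis
    using that(2) by blast
qed

lemma card_stable_models_le:
  assumes "finite P"
  shows "real (card {M. stable_model P M}) \<le> 2 powr (real (program_size P) / 4)"
  using assms
proof (induction "program_size P" arbitrary: P rule: less_induct)
  case less
  let ?S = "{M. stable_model P M}"
  show ?case
  \<comment> \<open>For nonempty \<open>P\<close> without stable models the condition holds
    vacuously.\<close>
  proof (cases "\<exists>r\<in>P. \<exists>q\<in>clause_atoms r. \<exists>b. \<forall>M\<in>?S. (q \<in> M) = b")
    case True
    then obtain r q b where *: "r \<in> P" "q \<in> clause_atoms r" "\<And>M. M \<in> ?S \<Longrightarrow> (q \<in> M) = b"
      by blast
    have "program_size (assign q b P) < program_size P"
      using less.prems *(1,2) by (rule program_size_assign_less)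
    moreover have "card ?S \<le> card {M. stable_model (assign q b P) M}"
      using less.prems *(3) by (intro card_stable_models_assign) auto
    moreover have "real (card {M. stable_model (assign q b P) M})
        \<le> 2 powr (real (program_size (assign q b P)) / 4)"
      by (intro less.hyps) (use calculation less.prems finite_assign in auto)
    ultimately have "real (card ?S) \<le> 2 powr (real (program_size (assign q b P)) / 4)"
      by linarith
    also have "\<dots> \<le> 2 powr (real (program_size P) / 4)"
      using \<open>program_size (assign q b P) < program_size P\<close> by simp
    finally show ?thesis .
  next
    case False
    have undetermined: "\<exists>M\<in>?S. (q \<in> M) \<noteq> b" if "r \<in> P" "q \<in> clause_atoms r" for r q b
      using False that by blast
    \<comment> \<open>A stable model containing \<open>q\<close> yields a supporting clause; one
      omitting \<open>q\<close> shows that this clause is no fact.\<close>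
    have head: "\<exists>r\<in>P. head r = q \<and> q \<notin> set (pos r) \<and> q \<notin> set (neg r) \<and> (pos r \<noteq> [] \<or> neg r \<noteq> [])"
      if s: "s \<in> P" "q \<in> clause_atoms s" for s q
    proof -
      obtain M where "stable_model P M" "q \<in> M"
        using undetermined[OF s, of False] by auto
      then obtain r where r: "r \<in> P" "head r = q" "q \<notin> set (pos r)" "q \<notin> set (neg r)"
        using stable_model_supported[of P M q] by auto
      moreover have "pos r \<noteq> [] \<or> neg r \<noteq> []"
        using undetermined[OF s, of True] stable_model_fact[OF _ r(1)] r(2) by auto
      ultimately show ?thesis
        by blast
    qed
    show ?thesis
    proof (cases "\<exists>s\<in>P. neg s \<noteq> []")
      case False
      then have "card ?S \<le> 1"
        by (intro card_stable_models_Horn_le) auto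
      then have "real (card ?S) \<le> 1"
        by simp
      also have "1 \<le> 2 powr (real (program_size P) / 4)"
        by (simp add: ge_one_powr_ge_zero)
      finally show ?thesis .
    next
      case True
      then obtain s q where s: "s \<in> P" "q \<in> set (neg s)"
        by (meson hd_in_set)
      then obtain r where r: "r \<in> P" "head r = q" "q \<notin> set (pos r)" "q \<notin> set (neg r)"
        "pos r \<noteq> [] \<or> neg r \<noteq> []"
        using head[of s q] by (auto simp: clause_atoms_def)
      \<comment> \<open>Four occurrences fewer halve the bound, so two branches of at most
        \<open>H\<close> each add up to it.\<close>
      define H where "H = 2 powr (real (program_size P) / 4) / 2"
      have IH: "real (card \<M>) \<le> H"
        if "card \<M> \<le> card {M. stable_model Q M}" "finite Q" "program_size Q + 4 \<le> program_size P"
        for \<M> :: "'a set set" and Q :: "'a program"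
      proof -
        have "real (card {M. stable_model Q M}) \<le> 2 powr (real (program_size Q) / 4)"
          using that by (intro less.hyps) auto
        also have "\<dots> \<le> 2 powr (real (program_size P) / 4 - 1)"
          using that(3) by simp
        also have "\<dots> = H"
          by (simp add: H_def powr_diff)
        finally show ?thesis
          using that(1) by linarith
      qed
      have "real (card {M \<in> ?S. q \<in> M}) \<le> H"
        using less.prems program_size_assign_true[OF less.prems r(1,2,4,5) s]
        by (intro IH[of _ "assign q True P"] card_stable_models_assign finite_assign) auto
      moreover have "real (card {M \<in> ?S. q \<notin> M}) \<le> H"
        using less.prems r(1,2,4,5) s
      proof (cases rule: program_size_assign_false)
        case 1
        then show ?thesis
          using less.prems
          by (intro IH[of _ "assign q False P"] card_stable_models_assign finite_assign) auto
      next
        case 2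
        \<comment> \<open>Since \<open>q\<close> is false, the single body literal of
          \<open>r\<close> is false in every model of this branch.\<close>
        obtain c d where c: "c \<in> clause_atoms r" "c \<noteq> q"
          and d: "\<And>M. M \<in> {M \<in> ?S. q \<notin> M} \<Longrightarrow> (c \<in> M) = d"
        proof (cases "pos r")
          case Nil
          then obtain c where c: "neg r = [c]"
            using 2(1) by (auto simp: clause_size_def length_Suc_conv)
          show thesis
            by (rule that[of c True])
              (use c Nil r in \<open>auto simp: clause_atoms_def stable_model_iff is_model_reduct\<close>)
        next
          case (Cons c cs)
          then have c: "pos r = [c]" "neg r = []"
            using 2(1) by (auto simp: clause_size_def)
          show thesis
            by (rule that[of c False])
              (use c r in \<open>auto simp: clause_atoms_def stable_model_iff is_model_reduct\<close>)
        qed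
        \<comment> \<open>\<open>r\<close> is gone, but \<open>c\<close> heads another clause, which
          survives; assigning \<open>c\<close> saves the missing fourth occurrence.\<close>
        obtain t where t: "t \<in> P" "head t = c"
          using head[OF r(1) c(1)] by blast
        have "strip q t \<in> assign q False P"
          using 2(3) t c(2) by simp
        then have "program_size (assign c d (assign q False P)) < program_size (assign q False P)"
          using less.prems t(2)
          by (intro program_size_assign_less[of _ "strip q t"] finite_assign)
            (auto simp: clause_atoms_def strip_def)
        then have size: "program_size (assign c d (assign q False P)) + 4 \<le> program_size P"
          using 2(2) by linarith
        have "card {M \<in> ?S. q \<notin> M} \<le> card {M. stable_model (assign c d (assign q False P)) M}"
          using less.prems c(2) d by (intro card_stable_models_assign(2)) auto
        then show ?thesis
          by (rule IH) (use less.prems size in \<open>auto intro!: finite_assign\<close>)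
      qed
      moreover have "card ?S = card {M \<in> ?S. q \<in> M} + card {M \<in> ?S. q \<notin> M}"
      proof -
        have "card ({M \<in> ?S. q \<in> M} \<union> {M \<in> ?S. q \<notin> M}) =
            card {M \<in> ?S. q \<in> M} + card {M \<in> ?S. q \<notin> M}"
          using finite_stable_models[OF less.prems] by (intro card_Un_disjoint) auto
        moreover have "{M \<in> ?S. q \<in> M} \<union> {M \<in> ?S. q \<notin> M} = ?S"
          by blast
        ultimately show ?thesis
          by simp
      qed
      ultimately show ?thesis
        by (simp add: H_def)
    qed
  qed
qed

subsection \<open>The lower bound\<close>

lemma exists_program_with_power_stable_models:
  "\<exists>P :: 'a::infinite program. finite P \<and> program_size P \<le> 4 * k \<and>
     2 ^ k \<le> card {M. stable_model P M}"
proof -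
  obtain g :: "nat \<Rightarrow> 'a" where g: "inj g"
    using infinite_countable_subset[OF infinite_UNIV] by blast
  \<comment> \<open>Even and odd indices give \<open>k\<close> disjoint pairs of atoms, one pair for
    each \<open>i\<close>.\<close>
  define f where "f i b = g (2 * i + of_bool b)" for i b
  have f: "f i b = f j c \<longleftrightarrow> i = j \<and> b = c" for i j b c
    by (cases b; cases c) (auto simp: f_def inj_eq[OF g], presburger+)
  define cl where "cl = (\<lambda>(i, b). Clause (f i b) [] [f i (\<not> b)])"
  define P where "P = cl ` ({..<k} \<times> UNIV)"
  \<comment> \<open>A subset \<open>A\<close> of \<open>{..<k}\<close> selects one atom from each
    pair.\<close>
  define Mod where "Mod A = (\<lambda>i. f i (i \<in> A)) ` {..<k}" for A
  have fin: "finite P"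
    by (simp add: P_def)
  have "program_size P \<le> (\<Sum>x\<in>{..<k} \<times> (UNIV :: bool set). clause_size (cl x))"
    unfolding program_size_def P_def
    using sum_image_le[of "{..<k} \<times> (UNIV :: bool set)" clause_size cl] by (simp add: o_def)
  also have "\<dots> = (\<Sum>x\<in>{..<k} \<times> (UNIV :: bool set). 2)"
    by (rule sum.cong) (auto simp: cl_def clause_size_def)
  finally have size: "program_size P \<le> 4 * k"
    by simp
  have Mod: "f i b \<in> Mod A \<longleftrightarrow> i < k \<and> b = (i \<in> A)" for i b A
    by (auto simp: Mod_def f)
  have "stable_model P (Mod A)" for A
    unfolding stable_model_iff is_model_reduct
  proof (intro conjI ballI impI allI subsetI)
    fix r assume "r \<in> P" "set (neg r) \<inter> Mod A = {}"
    then show "head r \<in> Mod A"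
      by (auto simp: P_def cl_def Mod)
  next
    fix N a assume N: "\<forall>r\<in>P. set (neg r) \<inter> Mod A = {} \<longrightarrow> set (pos r) \<subseteq> N \<longrightarrow> head r \<in> N"
      and "a \<in> Mod A"
    then obtain i where i: "i < k" "a = f i (i \<in> A)"
      by (auto simp: Mod_def)
    \<comment> \<open>Its negated atom is the unselected one, so the reduct contains the selected
      atom as a fact.\<close>
    then have "cl (i, i \<in> A) \<in> P"
      by (simp add: P_def)
    with N have "head (cl (i, i \<in> A)) \<in> N"
      by (auto simp: cl_def Mod)
    then show "a \<in> N"
      by (simp add: cl_def i(2))
  qed
  moreover have "inj_on Mod (Pow {..<k})"
  proof (rule inj_onI)
    fix A B assume AB: "A \<in> Pow {..<k}" "B \<in> Pow {..<k}" "Mod A = Mod B"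
    have "i \<in> A \<longleftrightarrow> i \<in> B" for i
      using AB Mod[of i True A] Mod[of i True B] by auto
    then show "A = B"
      by blast
  qed
  ultimately have "card (Pow {..<k}) \<le> card {M. stable_model P M}"
    using finite_stable_models[OF fin] by (intro card_inj_on_le[of Mod]) auto
  then show ?thesis
    using fin size by (auto simp: card_Pow)
qed

section \<open>Combining the bounds\<close>

theorem theorem6:
  "\<exists>c C :: real. 0 < c \<and> 0 < C \<and>
     (\<forall>n\<ge>1. c * 2 powr (real n / 4) \<le> real (s' TYPE('a::infinite) n) \<and>
             real (s' TYPE('a) n) \<le> C * 2 powr (real n / 4))"
\<comment> \<open>The factor 1/2 absorbs rounding: \<open>n div 4\<close> exceeds n/4 - 1. The upper
  bound holds with constant 1.\<close>
proof (rule exI[of _ "1 / 2"], rule exI[of _ 1], intro conjI allI impI)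
  fix n :: nat
  obtain P :: "'a program" where P: "finite P" "program_size P \<le> 4 * (n div 4)"
    "2 ^ (n div 4) \<le> card {M. stable_model P M}"
    using exists_program_with_power_stable_models by blast
  then have "card {M. stable_model P M} \<in> stable_model_counts TYPE('a) n"
    by (force simp: stable_model_counts_def)
  then have "2 ^ (n div 4) \<le> s' TYPE('a) n"
    unfolding s'_def using P(3) by (meson Max_ge finite_stable_model_counts order_trans)
  then have "2 powr real (n div 4) \<le> real (s' TYPE('a) n)"
    by (metis numeral_power_le_of_nat_cancel_iff powr_realpow zero_less_numeral)
  moreover have "1 / 2 * 2 powr (real n / 4) = 2 powr (real n / 4 - 1)"
    by (simp add: powr_diff)
  moreover have "\<dots> \<le> 2 powr real (n div 4)"
    by (rule powr_mono) linarith+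
  ultimately show "1 / 2 * 2 powr (real n / 4) \<le> real (s' TYPE('a) n)"
    by linarith
next
  fix n :: nat
  have "s' TYPE('a) n \<in> stable_model_counts TYPE('a) n"
    unfolding s'_def
    by (intro Max_in finite_stable_model_counts stable_model_counts_nonempty)
  then obtain P :: "'a program" where P: "finite P" "program_size P \<le> n"
    "s' TYPE('a) n = card {M. stable_model P M}"
    by (auto simp: stable_model_counts_def)
  have "real (s' TYPE('a) n) \<le> 2 powr (real (program_size P) / 4)"
    unfolding P(3) using P(1) by (rule card_stable_models_le)
  also have "\<dots> \<le> 1 * 2 powr (real n / 4)"
    using P(2) by simp
  finally show "real (s' TYPE('a) n) \<le> 1 * 2 powr (real n / 4)" .
qed simp_all

end
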